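(* Contraction is admissible for Herbrand proofs: for every sequent $\Gamma$ and every formula $A$ of first-order logic, if the sequent $\Gamma, A, A$ has an Herbrand proof, then the sequent $\Gamma, A$ has an Herbrand proof.
   Context: Setting. Pure first-order logic (no equality, no nonlogical axioms) over a signature of relation symbols and function symbols containing at least one constant symbol. Formulae are always in negation normal form: built from atoms and negated atoms with $\land,\lor,\forall,\exists$, the negation of a general formula being given by the De Morgan laws. Formulae are considered modulo renaming of bound variables ($\alpha$-equivalence). A formula is alpha-normal if, for each variable $x$, it contains at most one occurrence of a quantifier $\forall x$ or $\exists x$; every formula is $\alpha$-equivalent to an alpha-normal one. Bound variables are chosen distinct from free variables, so that no capture occurs. A formula is in prenex normal form if it has the form $Q.M$ with $Q$ a sequence of quantifiers and $M$ quantifier-free; $M$ is its matrix. A (one-sided) sequent $\Gamma=A_1,\dots,A_n$ is a finite sequence of formulae, and $\bigvee\Gamma$ is the disjunction of its members. Strong $\lor$-expansion. A strong $\lor$-expansion of a formula $A$ is any formula obtained from $A$ by finitely many (possibly zero) applications of the following operation: in the current strong $\lor$-expansion $A'$ of $A$, replace a subformula occurrence $B$ whose outermost connective is an existential quantifier by $B\lor B$. (Bound variables may then be renamed to make the result alpha-normal.) A strong $\lor$-expansion $\hat\Gamma$ of a sequent $\Gamma=A_1,\dots,A_n$ is a sequence $\hat A_1,\dots,\hat A_n$ of strong $\lor$-expansions of its members. Prenexification. A prenexification of an alpha-normal formula $A$ is a formula in prenex normal form derived from $A$ by successive applications of the operations $(qx.A)*B \rightsquigarrow qx.(A*B)$ and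 $A*(qx.B)\rightsquigarrow qx.(A*B)$, with $q\in\{\forall,\exists\}$ and $*\in\{\land,\lor\}$ (applied to subformulae). If $\bigvee\Gamma$ is alpha-normal, a prenexification of the sequent $\Gamma$ is a prenexification of $\bigvee\Gamma$. Witnessing substitution. Let $A$ be a valid alpha-normal formula in prenex normal form with $r\ge 0$ existential quantifiers, so that $A$ has the form $$(\forall x_1\cdots\forall x_{n_1})(\exists y_1)(\forall x_{n_1+1}\cdots\forall x_{n_2})(\exists y_2)\cdots(\exists y_r)(\forall x_{n_r+1}\cdots\forall x_{n_{r+1}})\,B(\bar x,\bar y)$$ with $B$ quantifier-free and $0\le n_1\le n_2\le\cdots\le n_{r+1}$. A witnessing substitution for $A$ is a sequence of terms $t_1,\dots,t_r$ such that (1) each $t_i$ may contain arbitrary free variables but, among bound variables, only variables from $x_1,\dots,x_{n_i}$; and (2) the formula $B(\bar x,t_1,\dots,t_r)$ is a (propositional) tautology. Herbrand proof of a sequent. An Herbrand proof of a sequent $\Gamma$ is a triple $(\hat\Gamma,\Gamma^*,\sigma)$ consisting of a strong $\lor$-expansion $\hat\Gamma$ of $\Gamma$, a prenexification $\Gamma^*$ of $\hat\Gamma$, and a witnessing substitution $\sigma$ for $\Gamma^*$. A rule is admissible for Herbrand proofs if, for each instance, whenever the premises have Herbrand proofs, so does the conclusion. *)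

theory Defs
  imports Main
begin

text \<open>
  Formulae modulo renaming of bound variables are represented with de Bruijn indices: \<open>Var n\<close>
  below \<open>k\<close> enclosing quantifiers is bound by the \<open>n\<close>-th of them (from the inside) if \<open>n < k\<close>, and is
  the free variable number \<open>n - k\<close> otherwise. An element of \<open>fm\<close> thus is an \<open>\<alpha>\<close>-equivalence
  class, each of which has an alpha-normal representative whose bound variables differ from its
  free ones; \<open>lift\<close> accounts for the choice of such a representative.

  The symbols of the signature are all elements of \<open>'f\<close> and of \<open>'r\<close>. Their arities are given by
  functions \<open>fa\<close> and \<open>ra\<close>; constants are the function symbols of arity 0.
\<close>

datatype 'f tm = Var nat | Fun 'f "'f tm list"

datatype quantifier = All | Ex

datatype connective = And | Or

datatype ('f, 'r) fm =
    Atom 'r "'f tm list"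
  | NegAtom 'r "'f tm list"
  | Conn connective "('f, 'r) fm" "('f, 'r) fm"
  | Quant quantifier "('f, 'r) fm"

fun wf_tm :: "('f \<Rightarrow> nat) \<Rightarrow> 'f tm \<Rightarrow> bool" where
  "wf_tm fa (Var n) \<longleftrightarrow> True"
| "wf_tm fa (Fun f ts) \<longleftrightarrow> length ts = fa f \<and> (\<forall>t\<in>set ts. wf_tm fa t)"

fun wf_fm :: "('f \<Rightarrow> nat) \<Rightarrow> ('r \<Rightarrow> nat) \<Rightarrow> ('f, 'r) fm \<Rightarrow> bool" where
  "wf_fm fa ra (Atom p ts) \<longleftrightarrow> length ts = ra p \<and> (\<forall>t\<in>set ts. wf_tm fa t)"
| "wf_fm fa ra (NegAtom p ts) \<longleftrightarrow> length ts = ra p \<and> (\<forall>t\<in>set ts. wf_tm fa t)"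
| "wf_fm fa ra (Conn c A B) \<longleftrightarrow> wf_fm fa ra A \<and> wf_fm fa ra B"
| "wf_fm fa ra (Quant q A) \<longleftrightarrow> wf_fm fa ra A"

fun subst_tm :: "(nat \<Rightarrow> 'f tm) \<Rightarrow> 'f tm \<Rightarrow> 'f tm" where
  "subst_tm s (Var n) = s n"
| "subst_tm s (Fun f ts) = Fun f (map (subst_tm s) ts)"

definition lift_subst :: "(nat \<Rightarrow> 'f tm) \<Rightarrow> nat \<Rightarrow> 'f tm" where
  "lift_subst s = case_nat (Var 0) (\<lambda>n. subst_tm (\<lambda>m. Var (Suc m)) (s n))"

fun subst :: "(nat \<Rightarrow> 'f tm) \<Rightarrow> ('f, 'r) fm \<Rightarrow> ('f, 'r) fm" where
  "subst s (Atom p ts) = Atom p (map (subst_tm s) ts)"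
| "subst s (NegAtom p ts) = NegAtom p (map (subst_tm s) ts)"
| "subst s (Conn c A B) = Conn c (subst s A) (subst s B)"
| "subst s (Quant q A) = Quant q (subst (lift_subst s) A)"

definition lift :: "('f, 'r) fm \<Rightarrow> ('f, 'r) fm" where
  "lift A = subst (\<lambda>n. Var (Suc n)) A"

text \<open>\<open>inst t A\<close> is the instance of the body \<open>A\<close> of a quantified formula at the term \<open>t\<close>.\<close>

definition inst :: "'f tm \<Rightarrow> ('f, 'r) fm \<Rightarrow> ('f, 'r) fm" where
  "inst t A = subst (case_nat t Var) A"

fun quantifier_free :: "('f, 'r) fm \<Rightarrow> bool" where
  "quantifier_free (Atom p ts) \<longleftrightarrow> True"
| "quantifier_free (NegAtom p ts) \<longleftrightarrow> True"
| "quantifier_free (Conn c A B) \<longleftrightarrow> quantifier_free A \<and> quantifier_free B"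
| "quantifier_free (Quant q A) \<longleftrightarrow> False"

fun prenex :: "('f, 'r) fm \<Rightarrow> bool" where
  "prenex (Quant q A) \<longleftrightarrow> prenex A"
| "prenex A \<longleftrightarrow> quantifier_free A"

text \<open>Only the value on quantifier-free formulae is meaningful.\<close>

fun prop_eval :: "('r \<Rightarrow> 'f tm list \<Rightarrow> bool) \<Rightarrow> ('f, 'r) fm \<Rightarrow> bool" where
  "prop_eval v (Atom p ts) \<longleftrightarrow> v p ts"
| "prop_eval v (NegAtom p ts) \<longleftrightarrow> \<not> v p ts"
| "prop_eval v (Conn And A B) \<longleftrightarrow> prop_eval v A \<and> prop_eval v B"
| "prop_eval v (Conn Or A B) \<longleftrightarrow> prop_eval v A \<or> prop_eval v B"
| "prop_eval v (Quant q A) \<longleftrightarrow> False"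

definition tautology :: "('f, 'r) fm \<Rightarrow> bool" where
  "tautology B \<longleftrightarrow> quantifier_free B \<and> (\<forall>v. prop_eval v B)"

inductive strong_expansion_step :: "('f, 'r) fm \<Rightarrow> ('f, 'r) fm \<Rightarrow> bool" where
  duplicate: "strong_expansion_step (Quant Ex A) (Conn Or (Quant Ex A) (Quant Ex A))"
| conn_left: "strong_expansion_step A A' \<Longrightarrow> strong_expansion_step (Conn c A B) (Conn c A' B)"
| conn_right: "strong_expansion_step B B' \<Longrightarrow> strong_expansion_step (Conn c A B) (Conn c A B')"
| quant: "strong_expansion_step A A' \<Longrightarrow> strong_expansion_step (Quant q A) (Quant q A')"

definition strong_expansion :: "('f, 'r) fm \<Rightarrow> ('f, 'r) fm \<Rightarrow> bool" where
  "strong_expansion = strong_expansion_step\<^sup>*\<^sup>*"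

inductive prenex_step :: "('f, 'r) fm \<Rightarrow> ('f, 'r) fm \<Rightarrow> bool" where
  pull_left: "prenex_step (Conn c (Quant q A) B) (Quant q (Conn c A (lift B)))"
| pull_right: "prenex_step (Conn c A (Quant q B)) (Quant q (Conn c (lift A) B))"
| conn_left: "prenex_step A A' \<Longrightarrow> prenex_step (Conn c A B) (Conn c A' B)"
| conn_right: "prenex_step B B' \<Longrightarrow> prenex_step (Conn c A B) (Conn c A B')"
| quant: "prenex_step A A' \<Longrightarrow> prenex_step (Quant q A) (Quant q A')"

definition prenexification :: "('f, 'r) fm \<Rightarrow> ('f, 'r) fm \<Rightarrow> bool" where
  "prenexification A P \<longleftrightarrow> prenex_step\<^sup>*\<^sup>* A P \<and> prenex P"

text \<open>
  \<open>witnessing fa P ts\<close>: \<open>ts\<close> is a witnessing substitution for the prenex formula \<open>P\<close>. The prefix is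
  processed from the outside. Passing a universal quantifier turns its variable into the free
  variable 0, and each existential variable is replaced by its witness. Hence, when the \<open>i\<close>-th
  existential quantifier is reached, the variables that its witness can refer to are exactly the
  universal variables to its left and the free variables of the language. The formula reached in
  the end is \<open>B(x, t\<^sub>1, \<dots>, t\<^sub>r)\<close>.
\<close>

inductive witnessing :: "('f \<Rightarrow> nat) \<Rightarrow> ('f, 'r) fm \<Rightarrow> 'f tm list \<Rightarrow> bool" for fa where
  matrix: "tautology B \<Longrightarrow> witnessing fa B []"
| universal: "witnessing fa A ts \<Longrightarrow> witnessing fa (Quant All A) ts"
| existential: "wf_tm fa t \<Longrightarrow> witnessing fa (inst t A) ts \<Longrightarrow> witnessing fa (Quant Ex A) (t # ts)"

text \<open>Unspecified on the empty list, as the language has no formula for falsity.\<close>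

fun disjunction :: "('f, 'r) fm list \<Rightarrow> ('f, 'r) fm" where
  "disjunction [A] = A"
| "disjunction (A # B # \<Gamma>) = Conn Or A (disjunction (B # \<Gamma>))"

definition herbrand_proof ::
  "('f \<Rightarrow> nat) \<Rightarrow> ('f, 'r) fm list \<Rightarrow> ('f, 'r) fm list \<times> ('f, 'r) fm \<times> 'f tm list \<Rightarrow> bool" where
  "herbrand_proof fa \<Gamma> = (\<lambda>(\<Gamma>', P, ts).
     \<Gamma> \<noteq> [] \<and> list_all2 strong_expansion \<Gamma> \<Gamma>' \<and> prenexification (disjunction \<Gamma>') P \<and>
     witnessing fa P ts)"

text \<open>
  A formula with a witnessing substitution is valid, so \<open>witnessing\<close> need not demand validity
  separately. This is the content of \<open>witnessing_valid\<close> below.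
\<close>

fun value_tm :: "('f \<Rightarrow> 'u list \<Rightarrow> 'u) \<Rightarrow> (nat \<Rightarrow> 'u) \<Rightarrow> 'f tm \<Rightarrow> 'u" where
  "value_tm F e (Var n) = e n"
| "value_tm F e (Fun f ts) = F f (map (value_tm F e) ts)"

fun sat :: "('f \<Rightarrow> 'u list \<Rightarrow> 'u) \<Rightarrow> ('r \<Rightarrow> 'u list \<Rightarrow> bool) \<Rightarrow> (nat \<Rightarrow> 'u) \<Rightarrow> ('f, 'r) fm \<Rightarrow> bool" where
  "sat F R e (Atom p ts) \<longleftrightarrow> R p (map (value_tm F e) ts)"
| "sat F R e (NegAtom p ts) \<longleftrightarrow> \<not> R p (map (value_tm F e) ts)"
| "sat F R e (Conn And A B) \<longleftrightarrow> sat F R e A \<and> sat F R e B"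
| "sat F R e (Conn Or A B) \<longleftrightarrow> sat F R e A \<or> sat F R e B"
| "sat F R e (Quant All A) \<longleftrightarrow> (\<forall>u. sat F R (case_nat u e) A)"
| "sat F R e (Quant Ex A) \<longleftrightarrow> (\<exists>u. sat F R (case_nat u e) A)"

lemma value_subst_tm: "value_tm F e (subst_tm s t) = value_tm F (\<lambda>n. value_tm F e (s n)) t"
  by (induction t) (auto simp: comp_def cong: map_cong)

lemma value_lift_subst:
  "(\<lambda>n. value_tm F (case_nat u e) (lift_subst s n)) = case_nat u (\<lambda>n. value_tm F e (s n))"
  by (auto simp: fun_eq_iff lift_subst_def value_subst_tm split: nat.split)

lemma sat_subst: "sat F R e (subst s A) \<longleftrightarrow> sat F R (\<lambda>n. value_tm F e (s n)) A"
proof (induction A arbitrary: s e)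
  case (Conn c A B)
  then show ?case by (cases c) simp_all
next
  case (Quant q A)
  then show ?case by (cases q) (simp_all add: value_lift_subst)
qed (simp_all add: value_subst_tm comp_def)

lemma sat_prop_eval:
  "quantifier_free B \<Longrightarrow> sat F R e B \<longleftrightarrow> prop_eval (\<lambda>p ts. R p (map (value_tm F e) ts)) B"
proof (induction B)
  case (Conn c A B)
  then show ?case by (cases c) simp_all
qed simp_all

lemma witnessing_valid: "witnessing fa P ts \<Longrightarrow> sat F R e P"
proof (induction arbitrary: e rule: witnessing.induct)
  case (existential t A ts)
  have "(\<lambda>n. value_tm F e (case_nat t Var n)) = case_nat (value_tm F e t) e"
    by (auto simp: fun_eq_iff split: nat.split)
  then show ?case
    using existential.IH[of e] by (auto simp: inst_def sat_subst)
qed (auto simp: tautology_def sat_prop_eval)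

end

theory Submission imports Defs begin

text \<open>
  A prenexification followed by a witnessing substitution amounts to the following game on the
  expanded formula: repeatedly pick a quantifier that lies below connectives only and delete it,
  replacing its variable by a fresh free variable if it is universal, and by a term if it is
  existential, until a tautology is left. The order in which quantifiers are deleted is the order
  of the prenex prefix. This is \<open>derivable\<close>, and \<open>derivable_iff_prenexification\<close> is the
  correspondence. The game involves no prefix, so that it can be analysed by induction.

  Let \<open>E\<^sub>1\<close> and \<open>E\<^sub>2\<close> be the two strong expansions of \<open>A\<close> in the given Herbrand proof. They
  differ from \<open>A\<close> only by disjunctions of existential formulae, so \<open>E\<^sub>1 \<or> E\<^sub>2\<close> can be merged into a
  single expansion of \<open>A\<close> by moving the disjunction inwards along \<open>A\<close>:
  it passes a connective by
  \<open>(B\<^sub>1 * C\<^sub>1) \<or> (B\<^sub>2 * C\<^sub>2) \<leadsto> (B\<^sub>1 \<or> B\<^sub>2) * (C\<^sub>1 \<or> C\<^sub>2)\<close>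
  and a universal quantifier by \<open>\<forall>x B\<^sub>1 \<or> \<forall>x B\<^sub>2 \<leadsto> \<forall>x (B\<^sub>1 \<or> B\<^sub>2)\<close>, it disappears at literals by
  \<open>a \<or> a \<leadsto> a\<close>, and it stops at an existential quantifier, where a disjunction of two expansions of
  \<open>\<exists>x B\<close> already is an expansion of \<open>\<exists>x B\<close> (\<open>strong_expansions_merge\<close>).

  It remains to see that these rewriting steps, applied anywhere, preserve derivability
  (\<open>derivable_contract_step\<close>). The rules for literals and connectives
  keep the occurrences of quantifiers, so the same deletions remain possible, and they weaken
  the matrix. For the merging of two universal quantifiers,
  note that deleting a universal quantifier can be advanced to any earlier moment
  (\<open>derivable_delete_universal\<close>) and that derivations are closed under substitution
  (\<open>derivable_subst\<close>): when one of the two quantifiers is deleted, one can delete the other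
  at once and identify the two fresh variables, which is what deleting the merged quantifier does.
\<close>

section \<open>Substitution\<close>

lemma subst_tm_subst_tm: "subst_tm s (subst_tm s' t) = subst_tm (\<lambda>n. subst_tm s (s' n)) t"
  by (induction t) simp_all

lemma subst_tm_Var: "subst_tm Var t = t"
  by (induction t) (simp_all add: map_idI)

lemma lift_subst_lift_subst:
  "subst_tm (lift_subst s) (lift_subst s' n) = lift_subst (\<lambda>n. subst_tm s (s' n)) n"
  by (cases n) (simp_all add: lift_subst_def subst_tm_subst_tm)

lemma subst_subst: "subst s (subst s' A) = subst (\<lambda>n. subst_tm s (s' n)) A"
  by (induction A arbitrary: s s') (simp_all add: subst_tm_subst_tm lift_subst_lift_subst)

lemma lift_subst_Var: "lift_subst Var = Var"
  by (auto simp: lift_subst_def fun_eq_iff split: nat.split)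

lemma subst_Var: "subst Var A = A"
  by (induction A) (simp_all add: lift_subst_Var subst_tm_Var map_idI)

lemma subst_lift: "subst (lift_subst s) (lift A) = lift (subst s A)"
  by (simp add: lift_def subst_subst) (simp add: lift_subst_def)

lemma subst_inst: "subst s (inst t A) = inst (subst_tm s t) (subst (lift_subst s) A)"
  unfolding inst_def subst_subst
  by (rule arg_cong[where f = "\<lambda>s. subst s A"])
    (auto simp: fun_eq_iff lift_subst_def subst_tm_subst_tm subst_tm_Var split: nat.split)

lemma inst_lift: "inst t (lift A) = A"
  by (simp add: inst_def lift_def subst_subst subst_Var)

lemma lift_simps [simp]:
  "lift (Atom p ts) = Atom p (map (subst_tm (\<lambda>n. Var (Suc n))) ts)"
  "lift (NegAtom p ts) = NegAtom p (map (subst_tm (\<lambda>n. Var (Suc n))) ts)"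
  "lift (Conn c A B) = Conn c (lift A) (lift B)"
  "lift (Quant q A) = Quant q (subst (lift_subst (\<lambda>n. Var (Suc n))) A)"
  by (simp_all add: lift_def)

lemma wf_subst_tm: "wf_tm fa t \<Longrightarrow> (\<And>n. wf_tm fa (s n)) \<Longrightarrow> wf_tm fa (subst_tm s t)"
  by (induction t) auto

lemma wf_lift_subst: "(\<And>n. wf_tm fa (s n)) \<Longrightarrow> wf_tm fa (lift_subst s n)"
  by (cases n) (simp_all add: lift_subst_def wf_subst_tm)

lemma quantifier_free_subst [simp]: "quantifier_free (subst s A) = quantifier_free A"
  by (induction A arbitrary: s) simp_all

lemma prenex_subst [simp]: "prenex (subst s A) = prenex A"
  by (induction A arbitrary: s) simp_all

lemma prop_eval_subst:
  "quantifier_free A \<Longrightarrow> prop_eval v (subst s A) = prop_eval (\<lambda>p ts. v p (map (subst_tm s) ts)) A"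
proof (induction A)
  case (Conn c A B)
  then show ?case by (cases c) simp_all
qed simp_all

lemma tautology_subst: "tautology A \<Longrightarrow> tautology (subst s A)"
  by (simp add: tautology_def prop_eval_subst)

lemma prenex_step_subst: "prenex_step A B \<Longrightarrow> prenex_step (subst s A) (subst s B)"
  by (induction arbitrary: s rule: prenex_step.induct)
    (auto simp: subst_lift intro: prenex_step.intros)

lemma Conn_eq_subst_iff:
  "Conn c X Y = subst s A \<longleftrightarrow> (\<exists>X0 Y0. A = Conn c X0 Y0 \<and> X = subst s X0 \<and> Y = subst s Y0)"
  by (cases A) auto

lemma Quant_eq_subst_iff:
  "Quant q X = subst s A \<longleftrightarrow> (\<exists>X0. A = Quant q X0 \<and> X = subst (lift_subst s) X0)"
  by (cases A) auto

text \<open>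
  Substitution does not affect the shape of a formula. So steps from an instance are instances of
  steps, which lets a prenexification of \<open>inst t A\<close> be carried out on \<open>A\<close>.
\<close>

lemma prenex_step_from_subst:
  "prenex_step (subst s A) B' \<Longrightarrow> \<exists>B. prenex_step A B \<and> B' = subst s B"
proof (induction "subst s A" B' arbitrary: s A rule: prenex_step.induct)
  case (pull_left c q X Y)
  then obtain X0 Y0 where "A = Conn c (Quant q X0) Y0" "X = subst (lift_subst s) X0" "Y = subst s Y0"
    by (auto simp: Conn_eq_subst_iff Quant_eq_subst_iff)
  then show ?case
    by (intro exI[of _ "Quant q (Conn c X0 (lift Y0))"])
      (simp add: subst_lift prenex_step.pull_left)
next
  case (pull_right c Y q X)
  then obtain X0 Y0 where "A = Conn c Y0 (Quant q X0)" "X = subst (lift_subst s) X0" "Y = subst s Y0"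
    by (auto simp: Conn_eq_subst_iff Quant_eq_subst_iff)
  then show ?case
    by (intro exI[of _ "Quant q (Conn c (lift Y0) X0)"])
      (simp add: subst_lift prenex_step.pull_right)
next
  case (conn_left X X' c Y)
  then obtain X0 Y0 where A: "A = Conn c X0 Y0" "X = subst s X0" "Y = subst s Y0"
    by (cases A) auto
  then show ?case
    using conn_left.hyps(2)[of s X0] by (metis prenex_step.conn_left subst.simps(3))
next
  case (conn_right X X' c Y)
  then obtain X0 Y0 where A: "A = Conn c Y0 X0" "X = subst s X0" "Y = subst s Y0"
    by (cases A) auto
  then show ?case
    using conn_right.hyps(2)[of s X0] by (metis prenex_step.conn_right subst.simps(3))
next
  case (quant X X' q)
  then obtain X0 where A: "A = Quant q X0" "X = subst (lift_subst s) X0"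
    by (cases A) auto
  then show ?case
    using quant.hyps(2)[of "lift_subst s" X0] by (metis prenex_step.quant subst.simps(4))
qed

lemma prenex_steps_from_subst:
  assumes "prenex_step\<^sup>*\<^sup>* (subst s A) B'"
  shows "\<exists>B. prenex_step\<^sup>*\<^sup>* A B \<and> B' = subst s B"
  using assms
proof (induction rule: rtranclp_induct)
  case (step B' C')
  then show ?case by (metis prenex_step_from_subst rtranclp.rtrancl_into_rtrancl)
qed blast

section \<open>Deleting exposed quantifiers\<close>

text \<open>
  \<open>G\<close> arises from \<open>F\<close> by deleting a quantifier \<open>q\<close> that is not in the scope of another one. The
  variable of this quantifier becomes the free variable 0 of \<open>G\<close>, for which the rest of the
  formula is shifted; an existential quantifier is dealt with by instantiating \<open>G\<close> afterwards.
\<close>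

inductive deletion :: "quantifier \<Rightarrow> ('f, 'r) fm \<Rightarrow> ('f, 'r) fm \<Rightarrow> bool" for q where
  here: "deletion q (Quant q A) A"
| left: "deletion q A A' \<Longrightarrow> deletion q (Conn c A B) (Conn c A' (lift B))"
| right: "deletion q B B' \<Longrightarrow> deletion q (Conn c A B) (Conn c (lift A) B')"

inductive_cases deletion_AtomE [elim!]: "deletion q (Atom p ts) G"
inductive_cases deletion_NegAtomE [elim!]: "deletion q (NegAtom p ts) G"
inductive_cases deletion_QuantE: "deletion q (Quant q' A) G"

lemma deletion_ConnE:
  assumes "deletion q (Conn c A B) G"
  obtains (in_left) A' where "G = Conn c A' (lift B)" "deletion q A A'"
  | (in_right) B' where "G = Conn c (lift A) B'" "deletion q B B'"
  using assms by (cases rule: deletion.cases) auto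

inductive derivable :: "('f \<Rightarrow> nat) \<Rightarrow> ('f, 'r) fm \<Rightarrow> bool" for fa where
  matrix: "tautology F \<Longrightarrow> derivable fa F"
| universal: "deletion All F G \<Longrightarrow> derivable fa G \<Longrightarrow> derivable fa F"
| existential:
    "deletion Ex F G \<Longrightarrow> wf_tm fa t \<Longrightarrow> derivable fa (inst t G) \<Longrightarrow> derivable fa F"

lemma deletion_subst: "deletion q F G \<Longrightarrow> deletion q (subst s F) (subst (lift_subst s) G)"
  by (induction rule: deletion.induct) (auto simp: subst_lift intro: deletion.intros)

lemma deletion_not_quantifier_free: "deletion q F G \<Longrightarrow> \<not> quantifier_free F"
  by (induction rule: deletion.induct) simp_all

text \<open>
  In particular, the free variables of a derivable formula may be renamed or identified.
\<close>

lemma derivable_subst: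
  assumes "derivable fa F" and "\<And>n. wf_tm fa (s n)"
  shows "derivable fa (subst s F)"
  using assms
proof (induction arbitrary: s rule: derivable.induct)
  case (matrix F)
  then show ?case by (simp add: derivable.matrix tautology_subst)
next
  case (universal F G)
  then show ?case by (meson derivable.universal deletion_subst wf_lift_subst)
next
  case (existential F G t)
  then have "derivable fa (inst (subst_tm s t) (subst (lift_subst s) G))"
    by (metis subst_inst)
  then show ?case
    using existential.hyps existential.prems
    by (meson derivable.existential deletion_subst wf_subst_tm)
qed

section \<open>Deletion of quantifiers and prenexification\<close>

lemma prenex_steps_conn_left: "prenex_step\<^sup>*\<^sup>* A A' \<Longrightarrow> prenex_step\<^sup>*\<^sup>* (Conn c A B) (Conn c A' B)"
  by (induction rule: rtranclp_induct)
    (auto intro: prenex_step.conn_left rtranclp.rtrancl_into_rtrancl)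

lemma prenex_steps_conn_right: "prenex_step\<^sup>*\<^sup>* B B' \<Longrightarrow> prenex_step\<^sup>*\<^sup>* (Conn c A B) (Conn c A B')"
  by (induction rule: rtranclp_induct)
    (auto intro: prenex_step.conn_right rtranclp.rtrancl_into_rtrancl)

lemma prenex_steps_quant: "prenex_step\<^sup>*\<^sup>* A A' \<Longrightarrow> prenex_step\<^sup>*\<^sup>* (Quant q A) (Quant q A')"
  by (induction rule: rtranclp_induct)
    (auto intro: prenex_step.quant rtranclp.rtrancl_into_rtrancl)

lemma deletion_prenex_steps: "deletion q F G \<Longrightarrow> prenex_step\<^sup>*\<^sup>* F (Quant q G)"
proof (induction rule: deletion.induct)
  case (left A A' c B)
  then show ?case
    by (meson prenex_step.pull_left prenex_steps_conn_left rtranclp.rtrancl_into_rtrancl)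
next
  case (right B B' c A)
  then show ?case
    by (meson prenex_step.pull_right prenex_steps_conn_right rtranclp.rtrancl_into_rtrancl)
qed simp

lemma prenex_step_not_quantifier_free: "prenex_step F F' \<Longrightarrow> \<not> quantifier_free F'"
  by (induction rule: prenex_step.induct) simp_all

text \<open>
  Either the quantifier deleted is the one that was pulled out, and then deleting it before
  pulling gives the same formula, or the deletion does not interfere with the step.
\<close>

lemma deletion_before_prenex_step:
  assumes "prenex_step F F'" and "deletion q F' G'"
  shows "deletion q F G' \<or> (\<exists>G. deletion q F G \<and> prenex_step G G')"
  using assms
proof (induction arbitrary: G' rule: prenex_step.induct)
  case (pull_left c q' A B)
  then show ?case by (auto elim!: deletion_QuantE intro: deletion.intros)
next
  case (pull_right c A q' B)
  then show ?case by (auto elim!: deletion_QuantE intro: deletion.intros)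
next
  case (conn_left A A' c B)
  from conn_left.prems show ?case
  proof (cases rule: deletion_ConnE)
    case (in_left A'')
    then show ?thesis
      using conn_left.IH by (meson deletion.left prenex_step.conn_left)
  next
    case (in_right B')
    then show ?thesis
      using conn_left.hyps
      by (metis lift_def deletion.right prenex_step.conn_left prenex_step_subst)
  qed
next
  case (conn_right B B' c A)
  from conn_right.prems show ?case
  proof (cases rule: deletion_ConnE)
    case (in_left A')
    then show ?thesis
      using conn_right.hyps
      by (metis lift_def deletion.left prenex_step.conn_right prenex_step_subst)
  next
    case (in_right B'')
    then show ?thesis
      using conn_right.IH by (meson deletion.right prenex_step.conn_right)
  qed
next
  case (quant A A' q')
  then show ?case by (auto elim!: deletion_QuantE intro: deletion.intros)
qed

lemma derivable_before_prenex_step: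
  assumes "derivable fa F'" and "prenex_step F F'"
  shows "derivable fa F"
  using assms
proof (induction arbitrary: F rule: derivable.induct)
  case (matrix F')
  then show ?case by (simp add: prenex_step_not_quantifier_free tautology_def)
next
  case (universal F' G')
  then show ?case by (meson derivable.universal deletion_before_prenex_step)
next
  case (existential F' G' t)
  then show ?case
    by (metis derivable.existential inst_def deletion_before_prenex_step prenex_step_subst)
qed

lemma derivable_if_witnessing: "witnessing fa P ts \<Longrightarrow> derivable fa P"
  by (induction rule: witnessing.induct) (auto intro: derivable.intros deletion.here)

lemma derivable_imp_prenexification:
  "derivable fa F \<Longrightarrow> \<exists>P ts. prenexification F P \<and> witnessing fa P ts"
proof (induction rule: derivable.induct)
  case (matrix F)
  then have "prenex F" by (cases F) (simp_all add: tautology_def)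
  then show ?case
    using matrix by (auto simp: prenexification_def intro: witnessing.matrix)
next
  case (universal F G)
  then obtain P ts where "prenex_step\<^sup>*\<^sup>* G P" "prenex P" "witnessing fa P ts"
    by (auto simp: prenexification_def)
  then show ?case
    using deletion_prenex_steps[OF universal.hyps(1)]
    by (intro exI[of _ "Quant All P"] exI[of _ ts])
      (auto simp: prenexification_def intro: witnessing.universal prenex_steps_quant rtranclp_trans)
next
  case (existential F G t)
  then obtain P ts where "prenex_step\<^sup>*\<^sup>* (inst t G) P" "prenex P" "witnessing fa P ts"
    by (auto simp: prenexification_def)
  then obtain P' where "prenex_step\<^sup>*\<^sup>* G P'" "prenex P'" "witnessing fa (inst t P') ts"
    unfolding inst_def using prenex_steps_from_subst by fastforce
  then show ?case
    using deletion_prenex_steps[OF existential.hyps(1)] existential.hyps(2)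
    by (intro exI[of _ "Quant Ex P'"] exI[of _ "t # ts"])
      (auto simp: prenexification_def intro: witnessing.existential prenex_steps_quant rtranclp_trans)
qed

lemma derivable_iff_prenexification:
  "derivable fa F \<longleftrightarrow> (\<exists>P ts. prenexification F P \<and> witnessing fa P ts)"
proof
  assume "\<exists>P ts. prenexification F P \<and> witnessing fa P ts"
  then obtain P ts where "prenex_step\<^sup>*\<^sup>* F P" and "witnessing fa P ts"
    by (auto simp: prenexification_def)
  then show "derivable fa F"
    by (induction rule: converse_rtranclp_induct)
      (auto intro: derivable_if_witnessing derivable_before_prenex_step)
qed (rule derivable_imp_prenexification)

section \<open>Advancing the deletion of universal quantifiers\<close>

definition swap_vars :: "nat \<Rightarrow> 'f tm" where
  "swap_vars = case_nat (Var 1) (case_nat (Var 0) (\<lambda>n. Var (Suc (Suc n))))"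

lemma wf_swap_vars: "wf_tm fa (swap_vars n)"
  by (simp add: swap_vars_def split: nat.split)

text \<open>
  The variables of two quantifiers deleted in succession are numbered in the reverse order of
  deletion. Exchanging the order thus exchanges the free variables 0 and 1.
\<close>

lemma subst_swap_vars_lift:
  "subst swap_vars (lift A) = subst (lift_subst (\<lambda>n. Var (Suc n))) A"
  unfolding lift_def subst_subst
  by (rule arg_cong[where f = "\<lambda>s. subst s A"])
    (auto simp: fun_eq_iff swap_vars_def lift_subst_def split: nat.split)

lemma subst_swap_vars_lift':
  "subst swap_vars (subst (lift_subst (\<lambda>n. Var (Suc n))) A) = lift A"
  unfolding lift_def subst_subst
  by (rule arg_cong[where f = "\<lambda>s. subst s A"])
    (auto simp: fun_eq_iff swap_vars_def lift_subst_def split: nat.split)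

lemma subst_swap_vars_lift_lift: "subst swap_vars (lift (lift A)) = lift (lift A)"
  by (simp add: lift_def subst_subst swap_vars_def)

lemma deletion_diamond:
  assumes "deletion q F G" and "deletion q' F H"
  shows "q = q' \<and> G = H \<or> (\<exists>K. deletion q' G (subst swap_vars K) \<and> deletion q H K)"
  using assms
proof (induction arbitrary: H rule: deletion.induct)
  case (here A)
  then show ?case by (auto elim: deletion_QuantE)
next
  case (left A A' c B)
  from left.prems show ?case
  proof (cases rule: deletion_ConnE)
    case (in_left A'')
    from left.IH[OF in_left(2)] show ?thesis
    proof
      assume "\<exists>K. deletion q' A' (subst swap_vars K) \<and> deletion q A'' K"
      then obtain K where "deletion q' A' (subst swap_vars K)" "deletion q A'' K" by blast
      then show ?thesis
        using in_left(1)
        by (intro disjI2 exI[of _ "Conn c K (lift (lift B))"])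
          (auto simp: subst_swap_vars_lift_lift intro: deletion.left)
    qed (simp add: in_left(1))
  next
    case (in_right B')
    have "deletion q' (Conn c A' (lift B))
        (Conn c (lift A') (subst (lift_subst (\<lambda>n. Var (Suc n))) B'))"
      unfolding lift_def[of B] by (intro deletion.right deletion_subst in_right(2))
    moreover have "deletion q (Conn c (lift A) B')
        (Conn c (subst (lift_subst (\<lambda>n. Var (Suc n))) A') (lift B'))"
      unfolding lift_def[of A] by (intro deletion.left deletion_subst left.hyps)
    ultimately show ?thesis
      using in_right(1)
      by (intro disjI2 exI[of _ "Conn c (subst (lift_subst (\<lambda>n. Var (Suc n))) A') (lift B')"])
        (simp add: subst_swap_vars_lift subst_swap_vars_lift')
  qed
next
  case (right B B' c A)
  from right.prems show ?case
  proof (cases rule: deletion_ConnE)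
    case (in_left A')
    have "deletion q' (Conn c (lift A) B')
        (Conn c (subst (lift_subst (\<lambda>n. Var (Suc n))) A') (lift B'))"
      unfolding lift_def[of A] by (intro deletion.left deletion_subst in_left(2))
    moreover have "deletion q (Conn c A' (lift B))
        (Conn c (lift A') (subst (lift_subst (\<lambda>n. Var (Suc n))) B'))"
      unfolding lift_def[of B] by (intro deletion.right deletion_subst right.hyps)
    ultimately show ?thesis
      using in_left(1)
      by (intro disjI2 exI[of _ "Conn c (lift A') (subst (lift_subst (\<lambda>n. Var (Suc n))) B')"])
        (simp add: subst_swap_vars_lift subst_swap_vars_lift')
  next
    case (in_right B'')
    from right.IH[OF in_right(2)] show ?thesis
    proof
      assume "\<exists>K. deletion q' B' (subst swap_vars K) \<and> deletion q B'' K"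
      then obtain K where "deletion q' B' (subst swap_vars K)" "deletion q B'' K" by blast
      then show ?thesis
        using in_right(1)
        by (intro disjI2 exI[of _ "Conn c (lift (lift A)) K"])
          (auto simp: subst_swap_vars_lift_lift intro: deletion.right)
    qed (simp add: in_right(1))
  qed
qed

text \<open>
  The fresh variable imposes no condition on the moves that precede it in the given derivation, so
  that it can be introduced before them.
\<close>

lemma derivable_delete_universal:
  assumes "derivable fa F" and "deletion All F G"
  shows "derivable fa G"
  using assms
proof (induction arbitrary: G rule: derivable.induct)
  case (matrix F)
  then show ?case by (meson deletion_not_quantifier_free tautology_def)
next
  case (universal F H)
  from deletion_diamond[OF universal.prems universal.hyps(1)] show ?case
  proof
    assume "\<exists>K. deletion All G (subst swap_vars K) \<and> deletion All H K"
    then obtain K where K: "deletion All G (subst swap_vars K)" "deletion All H K" by blast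
    from K(2) have "derivable fa (subst swap_vars K)"
      by (intro derivable_subst universal.IH wf_swap_vars)
    with K(1) show ?thesis by (rule derivable.universal)
  qed (use universal.hyps in simp)
next
  case (existential F H t)
  obtain K where K: "deletion Ex G (subst swap_vars K)" "deletion All H K"
    using deletion_diamond[OF existential.prems existential.hyps(1)] by blast
  have "derivable fa (subst (lift_subst (case_nat t Var)) K)"
    using existential.IH[OF deletion_subst[OF K(2), of "case_nat t Var", folded inst_def]] .
  \<comment> \<open>The universal variable is now introduced before the witness, which must be shifted past it.\<close>
  moreover have "subst (lift_subst (case_nat t Var)) K =
      inst (subst_tm (\<lambda>n. Var (Suc n)) t) (subst swap_vars K)"
    unfolding inst_def subst_subst
    by (rule arg_cong[where f = "\<lambda>s. subst s K"])
      (auto simp: fun_eq_iff swap_vars_def lift_subst_def split: nat.split)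
  ultimately have "derivable fa (inst (subst_tm (\<lambda>n. Var (Suc n)) t) (subst swap_vars K))"
    by simp
  moreover have "wf_tm fa (subst_tm (\<lambda>n. Var (Suc n)) t)"
    using existential.hyps(2) by (simp add: wf_subst_tm)
  ultimately show ?case
    using derivable.existential[OF K(1)] by blast
qed

section \<open>Contraction as rewriting\<close>

inductive contract_step :: "('f, 'r) fm \<Rightarrow> ('f, 'r) fm \<Rightarrow> bool" where
  atom: "contract_step (Conn Or (Atom p ts) (Atom p ts)) (Atom p ts)"
| neg_atom: "contract_step (Conn Or (NegAtom p ts) (NegAtom p ts)) (NegAtom p ts)"
| medial: "contract_step (Conn Or (Conn c A B) (Conn c A' B')) (Conn c (Conn Or A A') (Conn Or B B'))"
| all: "contract_step (Conn Or (Quant All A) (Quant All B)) (Quant All (Conn Or A B))"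
| conn_left: "contract_step A A' \<Longrightarrow> contract_step (Conn c A B) (Conn c A' B)"
| conn_right: "contract_step B B' \<Longrightarrow> contract_step (Conn c A B) (Conn c A B')"
| quant: "contract_step A A' \<Longrightarrow> contract_step (Quant q A) (Quant q A')"

lemma contract_step_subst: "contract_step A B \<Longrightarrow> contract_step (subst s A) (subst s B)"
  by (induction arbitrary: s rule: contract_step.induct) (auto intro: contract_step.intros)

lemma contract_step_lift: "contract_step A B \<Longrightarrow> contract_step (lift A) (lift B)"
  by (simp add: lift_def contract_step_subst)

lemma contract_step_quantifier_free:
  "contract_step A B \<Longrightarrow> quantifier_free A \<Longrightarrow> quantifier_free B"
  by (induction rule: contract_step.induct) auto

lemma contract_step_prop_eval:
  "contract_step A B \<Longrightarrow> quantifier_free A \<Longrightarrow> prop_eval v A \<Longrightarrow> prop_eval v B"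
proof (induction rule: contract_step.induct)
  case (medial c A B A' B')
  then show ?case by (cases c) auto
next
  case (conn_left A A' c B)
  then show ?case by (cases c) auto
next
  case (conn_right B B' c A)
  then show ?case by (cases c) auto
qed auto

text \<open>
  A deletion before a contraction step can be repeated after it, except when it deletes one of two
  universal quantifiers that the step merges. In this case, deleting the other one as well and
  identifying the two variables is the deletion of the merged quantifier; the variables are 0
  and 1 in \<open>H\<close>, and \<open>inst (Var 0) H\<close> identifies them.
\<close>

lemma deletion_contract_step:
  assumes "contract_step F F'" and "deletion q F G"
  shows "(\<exists>G'. deletion q F' G' \<and> contract_step G G') \<or>
    q = All \<and> (\<exists>H. deletion All G H \<and> deletion All F' (inst (Var 0) H))"
  using assms
proof (induction arbitrary: G rule: contract_step.induct)
  case (medial c A B A' B')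
  then show ?case
    by (fastforce elim!: deletion_ConnE intro: deletion.intros contract_step.medial)
next
  case (all A B)
  have q: "q = All" using all by (auto elim!: deletion_ConnE deletion_QuantE)
  have id: "subst (case_nat (Var 0) Var) (subst (lift_subst (\<lambda>n. Var (Suc n))) C) = C"
    for C :: "('a, 'b) fm"
  proof -
    have "(\<lambda>n. subst_tm (case_nat (Var 0) Var) (lift_subst (\<lambda>n. Var (Suc n)) n)) =
        (Var :: nat \<Rightarrow> 'a tm)"
      by (auto simp: fun_eq_iff lift_subst_def split: nat.split)
    then show ?thesis by (simp add: subst_subst subst_Var)
  qed
  from all show ?case
  proof (cases rule: deletion_ConnE)
    case (in_left A')
    let ?H = "Conn Or (lift A) (subst (lift_subst (\<lambda>n. Var (Suc n))) B)"
    have "deletion All G ?H"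
      using in_left by (auto elim!: deletion_QuantE intro: deletion.intros)
    moreover have "inst (Var 0) ?H = Conn Or A B"
      using inst_lift[of "Var 0" A] by (simp add: inst_def id)
    ultimately show ?thesis
      using q by (metis deletion.here)
  next
    case (in_right B')
    let ?H = "Conn Or (subst (lift_subst (\<lambda>n. Var (Suc n))) A) (lift B)"
    have "deletion All G ?H"
      using in_right by (auto elim!: deletion_QuantE intro: deletion.intros)
    moreover have "inst (Var 0) ?H = Conn Or A B"
      using inst_lift[of "Var 0" B] by (simp add: inst_def id)
    ultimately show ?thesis
      using q by (metis deletion.here)
  qed
next
  case (conn_left A A' c B)
  from conn_left.prems show ?case
  proof (cases rule: deletion_ConnE)
    case (in_left A'')
    from conn_left.IH[OF in_left(2)] show ?thesis
    proof (elim disjE conjE exE)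
      fix H assume "q = All" "deletion All A'' H" "deletion All A' (inst (Var 0) H)"
      then show ?thesis
        using in_left(1) deletion.left[of All A' "inst (Var 0) H" c B]
        by (intro disjI2 conjI exI[of _ "Conn c H (lift (lift B))"])
          (auto simp: inst_def inst_lift[unfolded inst_def] intro: deletion.left)
    qed (use in_left(1) in \<open>blast intro: deletion.left contract_step.conn_left\<close>)
  next
    case (in_right B')
    then show ?thesis
      using conn_left.hyps by (blast intro: deletion.right contract_step.conn_left contract_step_lift)
  qed
next
  case (conn_right B B' c A)
  from conn_right.prems show ?case
  proof (cases rule: deletion_ConnE)
    case (in_left A')
    then show ?thesis
      using conn_right.hyps by (blast intro: deletion.left contract_step.conn_right contract_step_lift)
  next
    case (in_right B'')
    from conn_right.IH[OF in_right(2)] show ?thesis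
    proof (elim disjE conjE exE)
      fix H assume "q = All" "deletion All B'' H" "deletion All B' (inst (Var 0) H)"
      then show ?thesis
        using in_right(1) deletion.right[of All B' "inst (Var 0) H" c A]
        by (intro disjI2 conjI exI[of _ "Conn c (lift (lift A)) H"])
          (auto simp: inst_def inst_lift[unfolded inst_def] intro: deletion.right)
    qed (use in_right(1) in \<open>blast intro: deletion.right contract_step.conn_right\<close>)
  qed
next
  case (quant A A' q')
  then show ?case by (auto elim!: deletion_QuantE intro: deletion.here)
qed (auto elim!: deletion_ConnE)

text \<open>
  The induction follows the derivation, not the formula. The steps below a quantifier are
  therefore dealt with when this quantifier has been deleted.
\<close>

lemma derivable_contract_step:
  assumes "derivable fa F" and "contract_step F F'"
  shows "derivable fa F'"
  using assms
proof (induction arbitrary: F' rule: derivable.induct)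
  case (matrix F)
  then show ?case
    by (meson contract_step_prop_eval contract_step_quantifier_free derivable.matrix tautology_def)
next
  case (universal F G)
  from deletion_contract_step[OF universal.prems universal.hyps(1)] show ?case
  proof (elim disjE conjE exE)
    fix H assume H: "deletion All G H" "deletion All F' (inst (Var 0) H)"
    have "derivable fa (inst (Var 0) H)"
      unfolding inst_def
      by (intro derivable_subst derivable_delete_universal[OF universal.hyps(2) H(1)])
        (simp split: nat.split)
    with H(2) show ?thesis by (rule derivable.universal)
  qed (blast intro: universal.IH derivable.universal)
next
  case (existential F G t)
  then show ?case
    using deletion_contract_step[OF existential.prems existential.hyps(1)]
    by (metis contract_step_subst derivable.existential inst_def quantifier.distinct(1))
qed

lemma derivable_contract_steps:
  "contract_step\<^sup>*\<^sup>* F F' \<Longrightarrow> derivable fa F \<Longrightarrow> derivable fa F'"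
  by (induction rule: rtranclp_induct) (auto intro: derivable_contract_step)

lemma contract_steps_conn_left:
  "contract_step\<^sup>*\<^sup>* A A' \<Longrightarrow> contract_step\<^sup>*\<^sup>* (Conn c A B) (Conn c A' B)"
  by (induction rule: rtranclp_induct)
    (auto intro: contract_step.conn_left rtranclp.rtrancl_into_rtrancl)

lemma contract_steps_conn_right:
  "contract_step\<^sup>*\<^sup>* B B' \<Longrightarrow> contract_step\<^sup>*\<^sup>* (Conn c A B) (Conn c A B')"
  by (induction rule: rtranclp_induct)
    (auto intro: contract_step.conn_right rtranclp.rtrancl_into_rtrancl)

lemma contract_steps_quant:
  "contract_step\<^sup>*\<^sup>* A A' \<Longrightarrow> contract_step\<^sup>*\<^sup>* (Quant q A) (Quant q A')"
  by (induction rule: rtranclp_induct)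
    (auto intro: contract_step.quant rtranclp.rtrancl_into_rtrancl)

section \<open>Merging two strong expansions\<close>

inductive_cases expansion_step_AtomE: "strong_expansion_step (Atom p ts) E"
inductive_cases expansion_step_NegAtomE: "strong_expansion_step (NegAtom p ts) E"
inductive_cases expansion_step_ConnE: "strong_expansion_step (Conn c A B) E"
inductive_cases expansion_step_AllE: "strong_expansion_step (Quant All A) E"

lemma strong_expansion_Atom: "strong_expansion (Atom p ts) E \<longleftrightarrow> E = Atom p ts"
  unfolding strong_expansion_def
  by (rule iffI, erule converse_rtranclpE) (auto elim: expansion_step_AtomE)

lemma strong_expansion_NegAtom: "strong_expansion (NegAtom p ts) E \<longleftrightarrow> E = NegAtom p ts"
  unfolding strong_expansion_def
  by (rule iffI, erule converse_rtranclpE) (auto elim: expansion_step_NegAtomE)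

lemma strong_expansion_Conn:
  "strong_expansion A A' \<Longrightarrow> strong_expansion B B' \<Longrightarrow> strong_expansion (Conn c A B) (Conn c A' B')"
proof -
  assume "strong_expansion A A'"
  then have "strong_expansion_step\<^sup>*\<^sup>* (Conn c A B) (Conn c A' B)"
    unfolding strong_expansion_def
    by (induction rule: rtranclp_induct)
      (auto intro: strong_expansion_step.conn_left rtranclp.rtrancl_into_rtrancl)
  moreover assume "strong_expansion B B'"
  then have "strong_expansion_step\<^sup>*\<^sup>* (Conn c A' B) (Conn c A' B')"
    unfolding strong_expansion_def
    by (induction rule: rtranclp_induct)
      (auto intro: strong_expansion_step.conn_right rtranclp.rtrancl_into_rtrancl)
  ultimately show ?thesis
    unfolding strong_expansion_def by (rule rtranclp_trans)
qed

lemma strong_expansion_Quant: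
  "strong_expansion A A' \<Longrightarrow> strong_expansion (Quant q A) (Quant q A')"
  unfolding strong_expansion_def
  by (induction rule: rtranclp_induct)
    (auto intro: strong_expansion_step.quant rtranclp.rtrancl_into_rtrancl)

lemma strong_expansion_ConnE:
  assumes "strong_expansion (Conn c A B) E"
  obtains A' B' where "E = Conn c A' B'" "strong_expansion A A'" "strong_expansion B B'"
proof -
  have "\<exists>A' B'. E = Conn c A' B' \<and> strong_expansion A A' \<and> strong_expansion B B'"
    using assms unfolding strong_expansion_def
  proof (induction rule: rtranclp_induct)
    case (step E E')
    then show ?case by (auto elim!: expansion_step_ConnE intro: rtranclp.rtrancl_into_rtrancl)
  qed blast
  then show thesis using that by blast
qed

lemma strong_expansion_AllE:
  assumes "strong_expansion (Quant All A) E"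
  obtains A' where "E = Quant All A'" "strong_expansion A A'"
proof -
  have "\<exists>A'. E = Quant All A' \<and> strong_expansion A A'"
    using assms unfolding strong_expansion_def
  proof (induction rule: rtranclp_induct)
    case (step E E')
    then show ?case by (auto elim!: expansion_step_AllE intro: rtranclp.rtrancl_into_rtrancl)
  qed blast
  then show thesis using that by blast
qed

lemma strong_expansions_merge:
  assumes "strong_expansion A E1" and "strong_expansion A E2"
  shows "\<exists>E. strong_expansion A E \<and> contract_step\<^sup>*\<^sup>* (Conn Or E1 E2) E"
  using assms
proof (induction A arbitrary: E1 E2)
  case (Atom p ts)
  then show ?case by (auto simp: strong_expansion_Atom intro: r_into_rtranclp contract_step.atom)
next
  case (NegAtom p ts)
  then show ?case by (auto simp: strong_expansion_NegAtom intro: r_into_rtranclp contract_step.neg_atom)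
next
  case (Conn c A B)
  obtain A1 B1 where 1: "E1 = Conn c A1 B1" "strong_expansion A A1" "strong_expansion B B1"
    using Conn.prems(1) by (rule strong_expansion_ConnE)
  obtain A2 B2 where 2: "E2 = Conn c A2 B2" "strong_expansion A A2" "strong_expansion B B2"
    using Conn.prems(2) by (rule strong_expansion_ConnE)
  obtain A' where A': "strong_expansion A A'" "contract_step\<^sup>*\<^sup>* (Conn Or A1 A2) A'"
    using Conn.IH(1) 1 2 by blast
  obtain B' where B': "strong_expansion B B'" "contract_step\<^sup>*\<^sup>* (Conn Or B1 B2) B'"
    using Conn.IH(2) 1 2 by blast
  have "contract_step (Conn Or E1 E2) (Conn c (Conn Or A1 A2) (Conn Or B1 B2))"
    unfolding 1 2 by (rule contract_step.medial)
  also have "contract_step\<^sup>*\<^sup>* \<dots> (Conn c A' (Conn Or B1 B2))"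
    using A'(2) by (rule contract_steps_conn_left)
  also have "contract_step\<^sup>*\<^sup>* \<dots> (Conn c A' B')"
    using B'(2) by (rule contract_steps_conn_right)
  finally show ?case using A' B' by (blast intro: strong_expansion_Conn)
next
  case (Quant q A)
  show ?case
  proof (cases q)
    case All
    obtain A1 where 1: "E1 = Quant All A1" "strong_expansion A A1"
      using Quant.prems(1) unfolding All by (rule strong_expansion_AllE)
    obtain A2 where 2: "E2 = Quant All A2" "strong_expansion A A2"
      using Quant.prems(2) unfolding All by (rule strong_expansion_AllE)
    obtain A' where A': "strong_expansion A A'" "contract_step\<^sup>*\<^sup>* (Conn Or A1 A2) A'"
      using Quant.IH 1 2 by blast
    have "contract_step (Conn Or E1 E2) (Quant All (Conn Or A1 A2))"
      unfolding 1 2 by (rule contract_step.all)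
    also have "contract_step\<^sup>*\<^sup>* \<dots> (Quant All A')"
      using A'(2) by (rule contract_steps_quant)
    finally show ?thesis using A' All by (blast intro: strong_expansion_Quant)
  next
    case Ex
    have "strong_expansion (Quant Ex A) (Conn Or E1 E2)"
      using strong_expansion_Conn[OF Quant.prems, of Or] unfolding Ex strong_expansion_def
      by (meson converse_rtranclp_into_rtranclp strong_expansion_step.duplicate)
    then show ?thesis using Ex by blast
  qed
qed

section \<open>Admissibility of contraction\<close>

lemma disjunction_Cons: "\<Gamma> \<noteq> [] \<Longrightarrow> disjunction (B # \<Gamma>) = Conn Or B (disjunction \<Gamma>)"
  by (cases \<Gamma>) simp_all

lemma contract_steps_disjunction:
  "contract_step\<^sup>*\<^sup>* (Conn Or E1 E2) E \<Longrightarrow>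
   contract_step\<^sup>*\<^sup>* (disjunction (\<Gamma> @ [E1, E2])) (disjunction (\<Gamma> @ [E]))"
  by (induction \<Gamma>) (simp_all add: disjunction_Cons contract_steps_conn_right)

lemma ex_herbrand_proof_iff:
  "(\<exists>\<pi>. herbrand_proof fa \<Gamma> \<pi>) \<longleftrightarrow>
   \<Gamma> \<noteq> [] \<and> (\<exists>\<Gamma>'. list_all2 strong_expansion \<Gamma> \<Gamma>' \<and> derivable fa (disjunction \<Gamma>'))"
  by (auto simp: herbrand_proof_def derivable_iff_prenexification)

theorem corollary14:
  fixes fa :: "'f \<Rightarrow> nat" and ra :: "'r \<Rightarrow> nat"
    and \<Gamma> :: "('f, 'r) fm list" and A :: "('f, 'r) fm"
  assumes "\<exists>c. fa c = 0"
    and "\<forall>B\<in>set \<Gamma>. wf_fm fa ra B" and "wf_fm fa ra A"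
    and "\<exists>\<pi>. herbrand_proof fa (\<Gamma> @ [A, A]) \<pi>"
  shows "\<exists>\<pi>. herbrand_proof fa (\<Gamma> @ [A]) \<pi>"
proof -
  obtain \<Delta> where "list_all2 strong_expansion (\<Gamma> @ [A, A]) \<Delta>" and \<Delta>: "derivable fa (disjunction \<Delta>)"
    using assms(4) unfolding ex_herbrand_proof_iff by blast
  then obtain \<Gamma>' E1 E2 where \<Gamma>': "list_all2 strong_expansion \<Gamma> \<Gamma>'" "\<Delta> = \<Gamma>' @ [E1, E2]"
    and E12: "strong_expansion A E1" "strong_expansion A E2"
    by (auto simp: list_all2_append1 list_all2_Cons1)
  obtain E where E: "strong_expansion A E" "contract_step\<^sup>*\<^sup>* (Conn Or E1 E2) E"
    using strong_expansions_merge[OF E12] by blast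
  have "derivable fa (disjunction (\<Gamma>' @ [E]))"
    using derivable_contract_steps[OF contract_steps_disjunction[OF E(2)]] \<Delta> \<Gamma>'(2) by blast
  moreover have "list_all2 strong_expansion (\<Gamma> @ [A]) (\<Gamma>' @ [E])"
    using \<Gamma>'(1) E(1) by (simp add: list_all2_appendI)
  ultimately show ?thesis
    unfolding ex_herbrand_proof_iff by blast
qed

end
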